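(* Let $X$ be a connected CW complex, let $R$ be a commutative ring with unit, and let $x_0\in X$ be a point with $MR[\pi_{2,1}^X,x_0]=0$. Let $i:X-\{x_0\}\hookrightarrow X$ be the inclusion map, and assume that there exists $\alpha\in\widetilde{H}^\ast(X;R)$ with $\alpha\neq 0$ and $i^\ast(\alpha)=0\in\widetilde{H}^\ast(X-\{x_0\};R)$, that is, $i^\ast:\widetilde{H}^\ast(X;R)\to\widetilde{H}^\ast(X-\{x_0\};R)$ is not injective. Then $sec(\pi_{2,1}^X)=2$. In particular, $X$ has the fixed point property.
   Context: $F(X,2)=\{(x_1,x_2)\in X^2 : x_1\neq x_2\}$ with the subspace topology, and $\pi_{2,1}^X:F(X,2)\to X$ is $\pi_{2,1}^X(x_1,x_2)=x_1$. For a continuous map $f:X\to Y$ and $a\in Y$, the minimal root number is $MR[f,a]=\min\{|g^{-1}(a)| : g\simeq f\}$, the minimum over all continuous maps $g:X\to Y$ homotopic to $f$. For a continuous map $p:E\to B$, the sectional number $sec(p)$ is the minimal cardinality of open covers of $B$ such that each element $U$ of the cover admits a continuous local section of $p$, i.e. a continuous map $s:U\to E$ such that $p\circ s$ is the inclusion $U\hookrightarrow B$ ($sec(p)=\infty$ if no finite such cover exists). $X$ has the fixed point property if every continuous self-map of $X$ has a fixed point. $\widetilde{H}^\ast$ denotes reduced (singular) cohomology. *)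

theory Defs
  imports "HOL-Homology.Homology" "HOL-Library.Extended_Nat"
begin

section \<open>CW complexes\<close>

definition closed_disc :: "nat \<Rightarrow> (nat \<Rightarrow> real) topology" where
  "closed_disc n = subtopology (Euclidean_space n) {x. (\<Sum>i<n. (x i)\<^sup>2) \<le> 1}"

definition open_disc :: "nat \<Rightarrow> (nat \<Rightarrow> real) topology" where
  "open_disc n = subtopology (Euclidean_space n) {x. (\<Sum>i<n. (x i)\<^sup>2) < 1}"

definition disc_boundary :: "nat \<Rightarrow> (nat \<Rightarrow> real) set" where
  "disc_boundary n = {x \<in> topspace (Euclidean_space n). (\<Sum>i<n. (x i)\<^sup>2) = 1}"

text \<open>A cell decomposition is given by the set \<open>\<C>\<close> of open cells, the dimension \<open>d e\<close> and
  the characteristic map \<open>\<Phi> e\<close> of each cell \<open>e\<close>. The last two conjuncts are closure-finiteness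
  and the weak topology.\<close>

definition CW_structure ::
  "'a topology \<Rightarrow> 'a set set \<Rightarrow> ('a set \<Rightarrow> nat) \<Rightarrow> ('a set \<Rightarrow> (nat \<Rightarrow> real) \<Rightarrow> 'a) \<Rightarrow> bool" where
  "CW_structure X \<C> d \<Phi> \<longleftrightarrow>
     \<Union>\<C> = topspace X \<and> pairwise disjnt \<C> \<and>
     (\<forall>e\<in>\<C>. continuous_map (closed_disc (d e)) X (\<Phi> e) \<and>
            homeomorphic_map (open_disc (d e)) (subtopology X e) (\<Phi> e)) \<and>
     (\<forall>e\<in>\<C>. \<exists>\<F>\<subseteq>\<C>. finite \<F> \<and> (\<forall>e'\<in>\<F>. d e' < d e) \<and>
            \<Phi> e ` disc_boundary (d e) \<subseteq> \<Union>\<F>) \<and>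
     (\<forall>A\<subseteq>topspace X. closedin X A \<longleftrightarrow>
        (\<forall>e\<in>\<C>. closedin (closed_disc (d e)) {x \<in> topspace (closed_disc (d e)). \<Phi> e x \<in> A}))"

definition CW_complex :: "'a topology \<Rightarrow> bool" where
  "CW_complex X \<longleftrightarrow> Hausdorff_space X \<and> (\<exists>\<C> d \<Phi>. CW_structure X \<C> d \<Phi>)"

section \<open>Configuration space, root number, sectional number\<close>

text \<open>The projection of the configuration space to its first point is \<^const>\<open>fst\<close>.\<close>

definition config2 :: "'a topology \<Rightarrow> ('a \<times> 'a) topology" where
  "config2 X = subtopology (prod_topology X X) {(x, y). x \<noteq> y}"

text \<open>All infinite cardinalities are identified with \<open>\<infinity>\<close>.\<close>

definition ecard :: "'a set \<Rightarrow> enat" where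
  "ecard A = (if finite A then enat (card A) else \<infinity>)"

text \<open>In the following two definitions the infimum of a nonempty set of extended naturals is its
  minimum, and the infimum of the empty set is \<open>\<infinity>\<close>.\<close>

definition min_root_number :: "'a topology \<Rightarrow> 'b topology \<Rightarrow> ('a \<Rightarrow> 'b) \<Rightarrow> 'b \<Rightarrow> enat" where
  "min_root_number X Y f a =
     (INF g \<in> {g. homotopic_with (\<lambda>_. True) X Y g f}. ecard {x \<in> topspace X. g x = a})"

definition has_local_section :: "'e topology \<Rightarrow> 'b topology \<Rightarrow> ('e \<Rightarrow> 'b) \<Rightarrow> 'b set \<Rightarrow> bool" where
  "has_local_section E B p U \<longleftrightarrow>
     (\<exists>s. continuous_map (subtopology B U) E s \<and> (\<forall>x\<in>U. p (s x) = x))"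

definition sectional_number :: "'e topology \<Rightarrow> 'b topology \<Rightarrow> ('e \<Rightarrow> 'b) \<Rightarrow> enat" where
  "sectional_number E B p =
     (INF \<U> \<in> {\<U>. (\<forall>U\<in>\<U>. openin B U \<and> has_local_section E B p U) \<and> \<Union>\<U> = topspace B}. ecard \<U>)"

definition fixed_point_property :: "'a topology \<Rightarrow> bool" where
  "fixed_point_property X \<longleftrightarrow> (\<forall>f. continuous_map X X f \<longrightarrow> (\<exists>x\<in>topspace X. f x = x))"

section \<open>Reduced singular cohomology\<close>

text \<open>Cochains are the homomorphisms from the singular chain group to the additive group of \<open>R\<close>,
  made unique as functions by being \<^const>\<open>undefined\<close> outside the singular chains.\<close>

definition cochain_group ::
  "nat \<Rightarrow> ('r, 'm) ring_scheme \<Rightarrow> 'a topology \<Rightarrow> ('a chain \<Rightarrow> 'r) monoid" where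
  "cochain_group n R X =
     \<lparr>carrier = hom (chain_group n X) (add_monoid R) \<inter> extensional (singular_chain_set n X),
      monoid.mult = (\<lambda>\<phi> \<psi>. \<lambda>c\<in>singular_chain_set n X. \<phi> c \<oplus>\<^bsub>R\<^esub> \<psi> c),
      one = (\<lambda>c\<in>singular_chain_set n X. \<zero>\<^bsub>R\<^esub>)\<rparr>"

definition coboundary :: "nat \<Rightarrow> 'a topology \<Rightarrow> ('a chain \<Rightarrow> 'r) \<Rightarrow> 'a chain \<Rightarrow> 'r" where
  "coboundary n X \<phi> = (\<lambda>c\<in>singular_chain_set (Suc n) X. \<phi> (chain_boundary (Suc n) c))"

definition cocycles :: "nat \<Rightarrow> ('r, 'm) ring_scheme \<Rightarrow> 'a topology \<Rightarrow> ('a chain \<Rightarrow> 'r) set" where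
  "cocycles n R X =
     {\<phi> \<in> carrier (cochain_group n R X). coboundary n X \<phi> = \<one>\<^bsub>cochain_group (Suc n) R X\<^esub>}"

definition augmentation :: "'a chain \<Rightarrow> int" where
  "augmentation c = (\<Sum>\<sigma>\<in>Poly_Mapping.keys c. Poly_Mapping.lookup c \<sigma>)"

text \<open>Coboundaries of the dual of the augmented chain complex: in degree 0 these are the multiples
  of the augmentation, i.e. the 0-cochains that are constant on singular 0-simplices.\<close>

definition reduced_coboundaries ::
  "nat \<Rightarrow> ('r, 'm) ring_scheme \<Rightarrow> 'a topology \<Rightarrow> ('a chain \<Rightarrow> 'r) set" where
  "reduced_coboundaries n R X =
     (case n of
        0 \<Rightarrow> (\<lambda>r. \<lambda>c\<in>singular_chain_set 0 X. [augmentation c] \<cdot>\<^bsub>R\<^esub> r) ` carrier R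
      | Suc m \<Rightarrow> coboundary m X ` carrier (cochain_group m R X))"

text \<open>Degree -1 of the augmented complex is omitted: its cohomology vanishes for every nonempty
  space.\<close>

definition reduced_cohomology_group ::
  "nat \<Rightarrow> ('r, 'm) ring_scheme \<Rightarrow> 'a topology \<Rightarrow> ('a chain \<Rightarrow> 'r) set monoid" where
  "reduced_cohomology_group n R X =
     (cochain_group n R X)\<lparr>carrier := cocycles n R X\<rparr> Mod reduced_coboundaries n R X"

definition reduced_cohomology ::
  "('r, 'm) ring_scheme \<Rightarrow> 'a topology \<Rightarrow> (nat \<Rightarrow> ('a chain \<Rightarrow> 'r) set) monoid" where
  "reduced_cohomology R X = sum_group UNIV (\<lambda>n. reduced_cohomology_group n R X)"

definition cochain_map ::
  "nat \<Rightarrow> 'a topology \<Rightarrow> ('a \<Rightarrow> 'b) \<Rightarrow> ('b chain \<Rightarrow> 'r) \<Rightarrow> 'a chain \<Rightarrow> 'r" where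
  "cochain_map n X f \<phi> = (\<lambda>c\<in>singular_chain_set n X. \<phi> (chain_map n f c))"

text \<open>The map of degree \<open>n\<close> cohomology induced by \<open>f\<close> from \<open>X\<close> to \<open>Y\<close>. The product of the subgroup
  of coboundaries of \<open>X\<close> with the image of a coset is the coset of the image of any representative,
  see \<open>reduced_cohomology_map_coset\<close> below.\<close>

definition reduced_cohomology_map_deg ::
  "nat \<Rightarrow> ('r, 'm) ring_scheme \<Rightarrow> 'a topology \<Rightarrow> ('a \<Rightarrow> 'b) \<Rightarrow>
   ('b chain \<Rightarrow> 'r) set \<Rightarrow> ('a chain \<Rightarrow> 'r) set" where
  "reduced_cohomology_map_deg n R X f A =
     reduced_coboundaries n R X <#>\<^bsub>cochain_group n R X\<^esub> (cochain_map n X f ` A)"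

definition reduced_cohomology_map ::
  "('r, 'm) ring_scheme \<Rightarrow> 'a topology \<Rightarrow> ('a \<Rightarrow> 'b) \<Rightarrow>
   (nat \<Rightarrow> ('b chain \<Rightarrow> 'r) set) \<Rightarrow> nat \<Rightarrow> ('a chain \<Rightarrow> 'r) set" where
  "reduced_cohomology_map R X f \<alpha> = (\<lambda>n. reduced_cohomology_map_deg n R X f (\<alpha> n))"

subsection \<open>The constructions are well defined\<close>

lemma cochain_carrier_iff:
  "\<phi> \<in> carrier (cochain_group n R X) \<longleftrightarrow>
     \<phi> \<in> extensional (singular_chain_set n X) \<and>
     (\<forall>c. singular_chain n X c \<longrightarrow> \<phi> c \<in> carrier R) \<and>
     (\<forall>c d. singular_chain n X c \<longrightarrow> singular_chain n X d \<longrightarrow> \<phi> (c + d) = \<phi> c \<oplus>\<^bsub>R\<^esub> \<phi> d)"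
  by (auto simp: cochain_group_def hom_def Pi_iff)

lemma comm_group_cochain_group:
  assumes "cring R"
  shows "comm_group (cochain_group n R X)"
proof -
  interpret cring R by fact
  show ?thesis
  proof (rule comm_groupI)
    fix \<phi> \<psi> assume "\<phi> \<in> carrier (cochain_group n R X)" "\<psi> \<in> carrier (cochain_group n R X)"
    then show "\<phi> \<otimes>\<^bsub>cochain_group n R X\<^esub> \<psi> \<in> carrier (cochain_group n R X)"
      unfolding cochain_carrier_iff
      by (auto simp: cochain_group_def singular_chain_add a_ac)
  next
    show "\<one>\<^bsub>cochain_group n R X\<^esub> \<in> carrier (cochain_group n R X)"
      unfolding cochain_carrier_iff by (auto simp: cochain_group_def singular_chain_add)
  next
    fix \<phi> \<psi> \<theta> assume "\<phi> \<in> carrier (cochain_group n R X)" "\<psi> \<in> carrier (cochain_group n R X)"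
      "\<theta> \<in> carrier (cochain_group n R X)"
    then show "\<phi> \<otimes>\<^bsub>cochain_group n R X\<^esub> \<psi> \<otimes>\<^bsub>cochain_group n R X\<^esub> \<theta> =
       \<phi> \<otimes>\<^bsub>cochain_group n R X\<^esub> (\<psi> \<otimes>\<^bsub>cochain_group n R X\<^esub> \<theta>)"
      unfolding cochain_carrier_iff
      by (auto simp: cochain_group_def a_assoc fun_eq_iff restrict_def)
  next
    fix \<phi> \<psi> assume "\<phi> \<in> carrier (cochain_group n R X)" "\<psi> \<in> carrier (cochain_group n R X)"
    then show "\<phi> \<otimes>\<^bsub>cochain_group n R X\<^esub> \<psi> = \<psi> \<otimes>\<^bsub>cochain_group n R X\<^esub> \<phi>"
      unfolding cochain_carrier_iff
      by (auto simp: cochain_group_def a_comm fun_eq_iff restrict_def)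
  next
    fix \<phi> assume "\<phi> \<in> carrier (cochain_group n R X)"
    then show "\<one>\<^bsub>cochain_group n R X\<^esub> \<otimes>\<^bsub>cochain_group n R X\<^esub> \<phi> = \<phi>"
      unfolding cochain_carrier_iff
      by (auto simp: cochain_group_def fun_eq_iff restrict_def extensional_def)
  next
    fix \<phi> assume \<phi>: "\<phi> \<in> carrier (cochain_group n R X)"
    let ?\<psi> = "\<lambda>c\<in>singular_chain_set n X. \<ominus>\<^bsub>R\<^esub> \<phi> c"
    have "?\<psi> \<in> carrier (cochain_group n R X)"
      using \<phi> unfolding cochain_carrier_iff by (auto simp: singular_chain_add minus_add)
    moreover have "?\<psi> \<otimes>\<^bsub>cochain_group n R X\<^esub> \<phi> = \<one>\<^bsub>cochain_group n R X\<^esub>"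
      using \<phi> unfolding cochain_carrier_iff
      by (auto simp: cochain_group_def fun_eq_iff restrict_def l_neg)
    ultimately show "\<exists>\<psi>\<in>carrier (cochain_group n R X).
        \<psi> \<otimes>\<^bsub>cochain_group n R X\<^esub> \<phi> = \<one>\<^bsub>cochain_group n R X\<^esub>" by blast
  qed
qed

lemma group_cochain_group: "cring R \<Longrightarrow> Group.group (cochain_group n R X)"
  by (rule comm_group.axioms(2)[OF comm_group_cochain_group])

lemma coboundary_hom:
  assumes "cring R"
  shows "coboundary n X \<in> hom (cochain_group n R X) (cochain_group (Suc n) R X)"
proof -
  interpret cring R by fact
  have b: "singular_chain n X (chain_boundary (Suc n) c)" if "singular_chain (Suc n) X c" for c
    using singular_chain_boundary[OF that] by simp
  show ?thesis
    unfolding hom_def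
  proof (safe intro!: funcsetI)
    fix \<phi> assume "\<phi> \<in> carrier (cochain_group n R X)"
    then show "coboundary n X \<phi> \<in> carrier (cochain_group (Suc n) R X)"
      unfolding cochain_carrier_iff coboundary_def
      by (auto simp: b chain_boundary_add singular_chain_add)
  next
    fix \<phi> \<psi>
    show "coboundary n X (\<phi> \<otimes>\<^bsub>cochain_group n R X\<^esub> \<psi>) =
       coboundary n X \<phi> \<otimes>\<^bsub>cochain_group (Suc n) R X\<^esub> coboundary n X \<psi>"
      by (auto simp: coboundary_def cochain_group_def b fun_eq_iff restrict_def)
  qed
qed

lemma group_hom_coboundary:
  assumes "cring R"
  shows "group_hom (cochain_group n R X) (cochain_group (Suc n) R X) (coboundary n X)"
  by (simp add: group_hom_def group_hom_axioms_def assms coboundary_hom group_cochain_group)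

lemma cocycles_kernel:
  "cocycles n R X = kernel (cochain_group n R X) (cochain_group (Suc n) R X) (coboundary n X)"
  by (simp add: cocycles_def kernel_def)

lemma augmentation_add: "augmentation (a + b) = augmentation a + augmentation b"
proof -
  let ?S = "Poly_Mapping.keys a \<union> Poly_Mapping.keys b"
  have *: "augmentation c = (\<Sum>\<sigma>\<in>?S. Poly_Mapping.lookup c \<sigma>)" if "Poly_Mapping.keys c \<subseteq> ?S" for c
    unfolding augmentation_def
    by (rule sum.mono_neutral_left) (use that in \<open>auto simp: in_keys_iff\<close>)
  show ?thesis
    using *[of a] *[of b] *[of "a + b"] Poly_Mapping.keys_add[of a b]
    by (simp add: lookup_add sum.distrib)
qed

lemma augmentation_0: "augmentation 0 = 0"
  by (simp add: augmentation_def)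

lemma augmentation_minus: "augmentation (- a) = - augmentation a"
  using augmentation_add[of a "- a"] by (simp add: augmentation_0)

lemma augmentation_diff: "augmentation (a - b) = augmentation a - augmentation b"
  using augmentation_add[of a "- b"] by (simp add: augmentation_minus)

lemma augmentation_of: "augmentation (frag_of \<sigma>) = 1"
  by (simp add: augmentation_def)

lemma augmentation_boundary: "augmentation (chain_boundary (Suc 0) c) = 0"
  using subset_UNIV
proof (induction c rule: frag_induction)
  case zero
  show ?case by (simp add: augmentation_0)
next
  case (one \<sigma>)
  have "chain_boundary (Suc 0) (frag_of \<sigma>) =
      frag_of (singular_face (Suc 0) 0 \<sigma>) - frag_of (singular_face (Suc 0) (Suc 0) \<sigma>)"
    by (simp add: chain_boundary_of)
  then show ?case by (simp add: augmentation_diff augmentation_of)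
next
  case (diff a b)
  then show ?case by (simp add: chain_boundary_diff augmentation_diff)
qed

lemma augmentation_chain_map: "augmentation (chain_map p f c) = augmentation c"
  using subset_UNIV
proof (induction c rule: frag_induction)
  case zero
  show ?case by (simp add: augmentation_0)
next
  case (one \<sigma>)
  show ?case by (simp add: augmentation_of)
next
  case (diff a b)
  then show ?case by (simp add: chain_map_diff augmentation_diff)
qed

lemma subgroup_reduced_coboundaries:
  assumes "cring R"
  shows "subgroup (reduced_coboundaries n R X) (cochain_group n R X)"
proof (cases n)
  case (Suc m)
  interpret group_hom "cochain_group m R X" "cochain_group (Suc m) R X" "coboundary m X"
    by (rule group_hom_coboundary[OF assms])
  show ?thesis
    using img_is_subgroup by (simp add: Suc reduced_coboundaries_def)
next
  case 0
  interpret cring R by fact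
  let ?h = "\<lambda>r. \<lambda>c\<in>singular_chain_set 0 X. [augmentation c] \<cdot>\<^bsub>R\<^esub> r"
  have "?h \<in> hom (add_monoid R) (cochain_group 0 R X)"
    unfolding hom_def
  proof (safe intro!: funcsetI)
    fix r assume "r \<in> carrier (add_monoid R)"
    then show "?h r \<in> carrier (cochain_group 0 R X)"
      unfolding cochain_carrier_iff
      by (auto simp: augmentation_add add.int_pow_mult singular_chain_add)
  next
    fix r s assume "r \<in> carrier (add_monoid R)" "s \<in> carrier (add_monoid R)"
    then show "?h (r \<otimes>\<^bsub>add_monoid R\<^esub> s) = ?h r \<otimes>\<^bsub>cochain_group 0 R X\<^esub> ?h s"
      by (auto simp: cochain_group_def fun_eq_iff restrict_def add.int_pow_distrib)
  qed
  then interpret group_hom "add_monoid R" "cochain_group 0 R X" ?h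
    using group_cochain_group[OF assms] add.group_axioms
    by (simp add: group_hom_def group_hom_axioms_def)
  show ?thesis
    using img_is_subgroup by (simp add: 0 reduced_coboundaries_def)
qed

lemma reduced_coboundaries_subset_cocycles:
  assumes "cring R"
  shows "reduced_coboundaries n R X \<subseteq> cocycles n R X"
proof
  interpret cring R by fact
  fix \<phi> assume \<phi>: "\<phi> \<in> reduced_coboundaries n R X"
  then have car: "\<phi> \<in> carrier (cochain_group n R X)"
    using subgroup.subset[OF subgroup_reduced_coboundaries[OF assms]] by blast
  have "coboundary n X \<phi> = \<one>\<^bsub>cochain_group (Suc n) R X\<^esub>"
  proof (cases n)
    case 0
    then obtain r where r: "r \<in> carrier R"
      "\<phi> = (\<lambda>c\<in>singular_chain_set 0 X. [augmentation c] \<cdot>\<^bsub>R\<^esub> r)"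
      using \<phi> by (auto simp: reduced_coboundaries_def)
    show ?thesis
      using singular_chain_boundary[of "Suc 0" X]
      by (auto simp: 0 r coboundary_def cochain_group_def augmentation_boundary fun_eq_iff
          restrict_def add_pow_def)
  next
    case (Suc m)
    then obtain \<psi> where \<psi>: "\<psi> \<in> carrier (cochain_group m R X)" "\<phi> = coboundary m X \<psi>"
      using \<phi> by (auto simp: reduced_coboundaries_def)
    have z: "\<psi> 0 = \<zero>\<^bsub>R\<^esub>"
    proof -
      have "\<psi> 0 \<in> carrier R" "\<psi> (0 + 0) = \<psi> 0 \<oplus>\<^bsub>R\<^esub> \<psi> 0"
        using \<psi>(1) unfolding cochain_carrier_iff by (metis singular_chain_0)+
      then show ?thesis by (metis add.l_cancel_one add_0)
    qed
    have "\<psi> (chain_boundary (Suc m) (chain_boundary (Suc (Suc m)) c)) = \<zero>\<^bsub>R\<^esub>"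
      if "singular_chain (Suc (Suc m)) X c" for c
      using chain_boundary_boundary[OF that] z by simp
    then show ?thesis
      using singular_chain_boundary[of "Suc (Suc m)" X]
      by (auto simp: Suc \<psi> coboundary_def cochain_group_def fun_eq_iff restrict_def)
  qed
  with car show "\<phi> \<in> cocycles n R X" by (simp add: cocycles_def)
qed

lemma subgroup_cocycles:
  assumes "cring R"
  shows "subgroup (cocycles n R X) (cochain_group n R X)"
  unfolding cocycles_kernel
  using group_hom.subgroup_kernel[OF group_hom_coboundary[OF assms]] .

lemma comm_group_reduced_cohomology_group:
  assumes "cring R"
  shows "comm_group (reduced_cohomology_group n R X)"
proof -
  let ?Z = "(cochain_group n R X)\<lparr>carrier := cocycles n R X\<rparr>"
  interpret C: comm_group "cochain_group n R X"
    by (rule comm_group_cochain_group[OF assms])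
  interpret Z: comm_group ?Z
    by (rule group.group_comm_groupI[OF C.subgroup_imp_group[OF subgroup_cocycles[OF assms]]])
      (auto simp: cocycles_def C.m_comm)
  have "subgroup (reduced_coboundaries n R X) ?Z"
    by (rule C.subgroup_incl[OF subgroup_reduced_coboundaries subgroup_cocycles
          reduced_coboundaries_subset_cocycles]) (use assms in auto)
  then show ?thesis
    unfolding reduced_cohomology_group_def by (rule Z.abelian_FactGroup)
qed

lemma cochain_map_hom:
  assumes "cring R" "continuous_map X Y f"
  shows "cochain_map n X f \<in> hom (cochain_group n R Y) (cochain_group n R X)"
proof -
  interpret cring R by fact
  have b: "singular_chain n Y (chain_map n f c)" if "singular_chain n X c" for c
    using singular_chain_chain_map[OF that assms(2)] .
  show ?thesis
    unfolding hom_def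
  proof (safe intro!: funcsetI)
    fix \<phi> assume "\<phi> \<in> carrier (cochain_group n R Y)"
    then show "cochain_map n X f \<phi> \<in> carrier (cochain_group n R X)"
      unfolding cochain_carrier_iff cochain_map_def
      by (auto simp: b chain_map_add singular_chain_add)
  next
    fix \<phi> \<psi>
    show "cochain_map n X f (\<phi> \<otimes>\<^bsub>cochain_group n R Y\<^esub> \<psi>) =
       cochain_map n X f \<phi> \<otimes>\<^bsub>cochain_group n R X\<^esub> cochain_map n X f \<psi>"
      by (auto simp: cochain_map_def cochain_group_def b fun_eq_iff restrict_def)
  qed
qed

lemma coboundary_cochain_map:
  assumes "continuous_map X Y f"
  shows "coboundary n X (cochain_map n X f \<phi>) = cochain_map (Suc n) X f (coboundary n Y \<phi>)"
  using assms singular_chain_boundary[of "Suc n" X] singular_chain_chain_map[of "Suc n" X _ Y f]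
  by (auto simp: coboundary_def cochain_map_def fun_eq_iff restrict_def chain_boundary_chain_map)

lemma cochain_map_reduced_coboundaries:
  assumes "cring R" "continuous_map X Y f"
  shows "cochain_map n X f ` reduced_coboundaries n R Y \<subseteq> reduced_coboundaries n R X"
proof (cases n)
  case 0
  have "cochain_map 0 X f (\<lambda>c\<in>singular_chain_set 0 Y. [augmentation c] \<cdot>\<^bsub>R\<^esub> r) =
        (\<lambda>c\<in>singular_chain_set 0 X. [augmentation c] \<cdot>\<^bsub>R\<^esub> r)" for r
    using singular_chain_chain_map[of 0 X _ Y f] assms(2)
    by (auto simp: cochain_map_def fun_eq_iff restrict_def augmentation_chain_map)
  then show ?thesis by (auto simp: 0 reduced_coboundaries_def)
next
  case (Suc m)
  then show ?thesis
    using cochain_map_hom[OF assms, of m]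
    by (auto simp: reduced_coboundaries_def hom_def Pi_iff
        coboundary_cochain_map[OF assms(2), symmetric])
qed

lemma reduced_cohomology_map_coset:
  assumes R: "cring R" and f: "continuous_map X Y f" and \<phi>: "\<phi> \<in> cocycles n R Y"
  shows "reduced_cohomology_map_deg n R X f (reduced_coboundaries n R Y #>\<^bsub>cochain_group n R Y\<^esub> \<phi>) =
         reduced_coboundaries n R X #>\<^bsub>cochain_group n R X\<^esub> cochain_map n X f \<phi>"
    and "cochain_map n X f \<phi> \<in> cocycles n R X"
proof -
  let ?C = "cochain_group n R X" and ?D = "cochain_group n R Y" and ?f = "cochain_map n X f"
  let ?B = "reduced_coboundaries n R X" and ?B' = "reduced_coboundaries n R Y"
  interpret C: comm_group ?C by (rule comm_group_cochain_group[OF R])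
  interpret f: group_hom ?D ?C ?f
    using group_cochain_group[OF R] cochain_map_hom[OF R f]
    by (simp add: group_hom_def group_hom_axioms_def)
  have \<phi>': "\<phi> \<in> carrier ?D" using \<phi> by (simp add: cocycles_def)
  have B': "?B' \<subseteq> carrier ?D"
    by (rule subgroup.subset[OF subgroup_reduced_coboundaries[OF R]])
  have fB: "?f ` ?B' \<subseteq> ?B" by (rule cochain_map_reduced_coboundaries[OF R f])
  interpret B: subgroup ?B ?C by (rule subgroup_reduced_coboundaries[OF R])
  interpret B': subgroup ?B' ?D by (rule subgroup_reduced_coboundaries[OF R])
  show "reduced_cohomology_map_deg n R X f (?B' #>\<^bsub>?D\<^esub> \<phi>) = ?B #>\<^bsub>?C\<^esub> ?f \<phi>"
    unfolding reduced_cohomology_map_deg_def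
  proof
    show "?B <#>\<^bsub>?C\<^esub> ?f ` (?B' #>\<^bsub>?D\<^esub> \<phi>) \<subseteq> ?B #>\<^bsub>?C\<^esub> ?f \<phi>"
    proof
      fix z assume "z \<in> ?B <#>\<^bsub>?C\<^esub> ?f ` (?B' #>\<^bsub>?D\<^esub> \<phi>)"
      then obtain b b' where b: "b \<in> ?B" "b' \<in> ?B'"
        and z: "z = b \<otimes>\<^bsub>?C\<^esub> ?f (b' \<otimes>\<^bsub>?D\<^esub> \<phi>)"
        by (auto simp: set_mult_def r_coset_def)
      have b': "?f b' \<in> ?B" using b fB by blast
      have "z = (b \<otimes>\<^bsub>?C\<^esub> ?f b') \<otimes>\<^bsub>?C\<^esub> ?f \<phi>"
        using z b b' \<phi>' B'.mem_carrier B.mem_carrier by (simp add: C.m_assoc)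
      moreover have "b \<otimes>\<^bsub>?C\<^esub> ?f b' \<in> ?B" using b b' by simp
      ultimately show "z \<in> ?B #>\<^bsub>?C\<^esub> ?f \<phi>" by (auto simp: r_coset_def)
    qed
  next
    have "\<phi> \<in> ?B' #>\<^bsub>?D\<^esub> \<phi>"
      using B'.one_closed \<phi>' by (force simp: r_coset_def)
    then show "?B #>\<^bsub>?C\<^esub> ?f \<phi> \<subseteq> ?B <#>\<^bsub>?C\<^esub> ?f ` (?B' #>\<^bsub>?D\<^esub> \<phi>)"
      by (force simp: set_mult_def r_coset_def)
  qed
  have one: "cochain_map (Suc n) X f \<one>\<^bsub>cochain_group (Suc n) R Y\<^esub> = \<one>\<^bsub>cochain_group (Suc n) R X\<^esub>"
    using singular_chain_chain_map[of "Suc n" X _ Y f] f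
    by (auto simp: cochain_map_def cochain_group_def fun_eq_iff restrict_def)
  show "?f \<phi> \<in> cocycles n R X"
    using \<phi> \<phi>' one coboundary_cochain_map[OF f, of n \<phi>] by (simp add: cocycles_def)
qed

end

theory Submission
  imports Defs
begin

text \<open>
  Two constant choices of the second point give the upper bound: if \<open>x\<^sub>0 \<noteq> x\<^sub>1\<close>, then
  \<open>x \<mapsto> (x, x\<^sub>i)\<close> is a section of the projection over the open set \<open>X - {x\<^sub>i}\<close>, and these two sets
  cover \<open>X\<close>. A second point exists because a one-point space has no reduced cohomology
  (\<open>reduced_cohomology_singleton\<close>), whereas \<open>\<alpha> \<noteq> 0\<close>.

  For the lower bound suppose that the projection has a global section \<open>s\<close>. The hypothesis on the
  root number provides a map \<open>g\<close> homotopic to the projection that never takes the value \<open>x\<^sub>0\<close>. Then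
  \<open>r = g \<circ> s\<close> maps \<open>X\<close> into \<open>X - {x\<^sub>0}\<close>, and \<open>i \<circ> r\<close> is homotopic to (projection \<open>\<circ> s\<close>) = identity.
  Hence \<open>r\<^sup>* \<circ> i\<^sup>*\<close> is the identity of the reduced cohomology of \<open>X\<close>, so \<open>i\<^sup>*\<close> is injective,
  contrary to the existence of \<open>\<alpha>\<close>. So there is no global section, which excludes covers
  with fewer than two members. It also gives the fixed point property, since a self-map \<open>f\<close>
  without fixed points would yield the global section \<open>x \<mapsto> (x, f x)\<close>.

  The substantial ingredient is homotopy invariance of cohomology with arbitrary coefficients
  (\<open>homotopic_imp_cochain_map_cohomologous\<close>), which requires a chain homotopy between the chain maps
  induced by homotopic maps. It is built by the method of acyclic models: the prism
  \<open>[0, 1] \<times> \<Delta>\<^sup>q\<close> is contractible, so that a chain filling its prescribed boundary exists in every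
  dimension \<open>q\<close> (\<open>prism_chains_exist\<close>), and transporting these chains along singular simplices
  gives the homotopy (\<open>homotopic_imp_chain_homotopic\<close>).
\<close>

section \<open>Prism operators built from model chains\<close>

abbreviation prism_space :: "nat \<Rightarrow> (real \<times> (nat \<Rightarrow> real)) topology" where
  "prism_space q \<equiv>
     prod_topology (top_of_set {0..1}) (subtopology (powertop_real UNIV) (standard_simplex q))"

abbreviation identity_simplex :: "nat \<Rightarrow> (nat \<Rightarrow> real) chain" where
  "identity_simplex q \<equiv> frag_of (restrict id (standard_simplex q))"

text \<open>The operator \<open>c \<mapsto> [0, 1] \<times> c\<close>, where \<open>P\<close> is a chain representing the prism over the standard
  \<open>q\<close>-simplex. Taking \<open>P\<close> as a parameter separates the naturality of the operator, which holds for
  every \<open>P\<close>, from the choice of \<open>P\<close> that makes the boundary formula true.\<close>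

definition chain_prism ::
  "nat \<Rightarrow> (real \<times> (nat \<Rightarrow> real)) chain \<Rightarrow> 'a chain \<Rightarrow> (real \<times> 'a) chain" where
  "chain_prism q P c = frag_extend (\<lambda>\<sigma>. chain_map (Suc q) (map_prod id \<sigma>) P) c"

lemma chain_prism_0 [simp]: "chain_prism q P 0 = 0"
  by (simp add: chain_prism_def)

lemma chain_prism_of [simp]:
  "chain_prism q P (frag_of \<sigma>) = chain_map (Suc q) (map_prod id \<sigma>) P"
  by (simp add: chain_prism_def)

lemma chain_prism_add: "chain_prism q P (c + d) = chain_prism q P c + chain_prism q P d"
  by (simp add: chain_prism_def frag_extend_add)

lemma chain_prism_diff: "chain_prism q P (c - d) = chain_prism q P c - chain_prism q P d"
  by (simp add: chain_prism_def frag_extend_diff)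

lemma singular_chain_chain_prism:
  assumes P: "singular_chain (Suc q) (prism_space q) P" and c: "singular_chain q X c"
  shows "singular_chain (Suc q) (prod_topology (top_of_set {0..1}) X) (chain_prism q P c)"
  unfolding chain_prism_def
proof (rule singular_chain_extend)
  fix \<sigma> assume "\<sigma> \<in> Poly_Mapping.keys c"
  then have "continuous_map (subtopology (powertop_real UNIV) (standard_simplex q)) X \<sigma>"
    using c by (auto simp: singular_chain_def singular_simplex_def)
  then have "continuous_map (prism_space q) (prod_topology (top_of_set {0..1}) X) (map_prod id \<sigma>)"
    by (simp add: map_prod_def continuous_map_prod_top)
  then show "singular_chain (Suc q) (prod_topology (top_of_set {0..1}) X)
      (chain_map (Suc q) (map_prod id \<sigma>) P)"
    by (rule singular_chain_chain_map[OF P])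
qed

lemma chain_prism_chain_map:
  assumes P: "singular_chain (Suc q) (prism_space q) P"
  shows "chain_prism q P (chain_map q g c) = chain_map (Suc q) (map_prod id g) (chain_prism q P c)"
  using subset_UNIV
proof (induction c rule: frag_induction)
  case (one \<sigma>)
  have "chain_map (Suc q) (map_prod id (simplex_map q g \<sigma>)) P =
        chain_map (Suc q) (map_prod id g \<circ> map_prod id \<sigma>) P"
    by (rule chain_map_eq[OF P]) (auto simp: simplex_map_def)
  then show ?case by (simp only: chain_prism_of chain_map_of chain_map_compose comp_apply)
qed (simp_all add: chain_map_diff chain_prism_diff)

text \<open>The boundary of a prism consists of its top, its bottom and the prism over the boundary. By
  naturality it suffices to have this for the identity simplex, because every singular simplex \<open>\<sigma>\<close>
  is the image of the identity simplex under \<open>\<sigma>\<close>. The condition on \<open>P'\<close> is restricted to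
  positive degrees because a 0-simplex has no faces.\<close>

lemma chain_boundary_chain_prism:
  assumes P: "singular_chain (Suc q) (prism_space q) P"
    and P': "0 < q \<Longrightarrow> singular_chain q (prism_space (q - 1)) P'"
    and bd: "chain_boundary (Suc q) P =
      chain_map q (Pair 1) (identity_simplex q) - chain_map q (Pair 0) (identity_simplex q)
        - chain_prism (q - 1) P' (chain_boundary q (identity_simplex q))"
    and c: "singular_chain q X c"
  shows "chain_boundary (Suc q) (chain_prism q P c) =
    chain_map q (Pair 1) c - chain_map q (Pair 0) c - chain_prism (q - 1) P' (chain_boundary q c)"
  using c unfolding singular_chain_def
proof (induction c rule: frag_induction)
  case (one \<sigma>)
  then have \<sigma>: "singular_simplex q X \<sigma>" by simp
  let ?\<iota> = "identity_simplex q"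
  have \<sigma>\<iota>: "chain_map q \<sigma> ?\<iota> = frag_of \<sigma>"
    by (rule singular_simplex_chain_map_id[OF \<sigma>])
  have ends: "chain_map q (map_prod id \<sigma>) (chain_map q (Pair t) ?\<iota>) = chain_map q (Pair t) (frag_of \<sigma>)"
    for t :: real
  proof -
    have "map_prod id \<sigma> \<circ> Pair t = Pair t \<circ> \<sigma>" by auto
    then show ?thesis by (metis chain_map_compose comp_apply \<sigma>\<iota>)
  qed
  have sides: "chain_map q (map_prod id \<sigma>) (chain_prism (q - 1) P' (chain_boundary q ?\<iota>)) =
      chain_prism (q - 1) P' (chain_boundary q (frag_of \<sigma>))"
  proof (cases "q = 0")
    case False
    have \<iota>: "singular_chain q (subtopology (powertop_real UNIV) (standard_simplex q)) ?\<iota>"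
      by (simp add: singular_chain_of singular_simplex_def)
    have "chain_prism (q - 1) P' (chain_boundary q (frag_of \<sigma>)) =
        chain_prism (q - 1) P' (chain_map (q - 1) \<sigma> (chain_boundary q ?\<iota>))"
      using chain_boundary_chain_map[OF \<iota>, of \<sigma>] \<sigma>\<iota> by simp
    also have "\<dots> = chain_map (Suc (q - 1)) (map_prod id \<sigma>) (chain_prism (q - 1) P' (chain_boundary q ?\<iota>))"
      using P' False by (intro chain_prism_chain_map) auto
    finally show ?thesis using False by simp
  qed (simp add: chain_boundary_def)
  have "chain_boundary (Suc q) (chain_prism q P (frag_of \<sigma>)) =
      chain_map q (map_prod id \<sigma>) (chain_boundary (Suc q) P)"
    using chain_boundary_chain_map[OF P] by simp
  then show ?case
    by (simp only: bd chain_map_diff ends sides)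
qed (simp_all add: chain_boundary_diff chain_prism_diff chain_map_diff)

section \<open>Existence of the model chains\<close>

lemma contractible_space_standard_simplex:
  "contractible_space (subtopology (powertop_real UNIV) (standard_simplex q))"
proof -
  let ?\<Delta> = "subtopology (powertop_real UNIV) (standard_simplex q)"
  define v :: "nat \<Rightarrow> real" where "v = (\<lambda>j. if j = 0 then 1 else 0)"
  have v: "v \<in> standard_simplex q" by (simp add: v_def)
  let ?h = "\<lambda>(t, x) i. (1 - t) * x i + t * v i"
  have "continuous_map (prod_topology (top_of_set {0..1}) ?\<Delta>) ?\<Delta> ?h"
  proof (intro continuous_map_into_subtopology)
    have fst: "continuous_map (prod_topology (top_of_set {0..1}) ?\<Delta>) euclideanreal fst"
      by (rule continuous_map_into_fulltopology[OF continuous_map_fst])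
    have snd: "continuous_map (prod_topology (top_of_set {0..1}) ?\<Delta>) euclideanreal (\<lambda>z. snd z i)" for i
      using continuous_map_compose[OF continuous_map_snd[of "top_of_set {0..1}" ?\<Delta>]
          continuous_map_from_subtopology[OF continuous_map_product_projection[of i UNIV "\<lambda>_. euclideanreal"]]]
      by (simp add: comp_def)
    show "continuous_map (prod_topology (top_of_set {0..1}) ?\<Delta>) (powertop_real UNIV) ?h"
      unfolding continuous_map_componentwise_UNIV
      using fst snd by (auto simp: case_prod_unfold intro!: continuous_intros)
    show "?h \<in> topspace (prod_topology (top_of_set {0..1}) ?\<Delta>) \<rightarrow> standard_simplex q"
      using v by (auto simp: convex_standard_simplex)
  qed
  then have "homotopic_with (\<lambda>_. True) ?\<Delta> ?\<Delta> id (\<lambda>_. v)"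
    unfolding homotopic_with_def by (intro exI[of _ ?h]) auto
  then show ?thesis unfolding contractible_space_def by blast
qed

lemma contractible_space_prism_space: "contractible_space (prism_space q)"
proof -
  have "contractible_space (top_of_set {0..1::real})"
    unfolding contractible_space_top_of_set by (rule convex_imp_contractible) simp
  then show ?thesis
    unfolding contractible_space_prod_topology using contractible_space_standard_simplex by blast
qed

text \<open>The contraction moves a cycle to a cycle of a one-point subspace, and there the claim is the
  degeneration of homology in positive degrees.\<close>

lemma cycle_imp_boundary_contractible_space:
  assumes X: "contractible_space X" and n: "0 < n" and c: "singular_relcycle n X {} c"
  shows "singular_relboundary n X {} c"
proof -
  obtain a where a: "homotopic_with (\<lambda>_. True) X X id (\<lambda>_. a)"
    using X unfolding contractible_space_def by blast
  have "homologous_rel n X {} (chain_map n id c) (chain_map n (\<lambda>_. a) c)"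
    by (rule homotopic_imp_homologous_rel_chain_maps[OF _ c]) (use a in simp)
  then have hom: "homologous_rel n X {} c (chain_map n (\<lambda>_. a) c)"
    using c chain_map_ident by (metis singular_cycle)
  have "singular_relboundary n X {} (chain_map n (\<lambda>_. a) c)"
  proof (cases "topspace X = {}")
    case True
    then show ?thesis using c by (simp add: singular_cycle singular_chain_empty)
  next
    case False
    let ?pt = "subtopology X {a}"
    have aX: "a \<in> topspace X"
      using homotopic_with_imp_continuous_maps[OF a] False by (auto simp: continuous_map_def)
    then have pt: "topspace ?pt = {a}" by auto
    have "singular_relcycle n ?pt {} (chain_map n (\<lambda>_. a) c)"
      by (rule singular_relcycle_chain_map[OF c]) (use aX in auto)
    then have "singular_relboundary n ?pt {} (chain_map n (\<lambda>_. a) c)"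
      using singular_boundary_eq_cycle_singleton[OF pt] n by simp
    then show ?thesis
      using singular_boundary_mono[of "{a}" UNIV n X] by simp
  qed
  with hom show ?thesis
    unfolding homologous_rel_def using singular_relboundary_add by fastforce
qed

text \<open>The chains are chosen by recursion on \<open>q\<close>. Once the boundary formula holds in degree \<open>q\<close>, the
  prescribed boundary in degree \<open>q + 1\<close> is a cycle of a contractible space, so it can be filled.\<close>

lemma prism_chains_exist:
  obtains P where "\<And>q. singular_chain (Suc q) (prism_space q) (P q)"
    and "\<And>q. chain_boundary (Suc q) (P q) =
      chain_map q (Pair 1) (identity_simplex q) - chain_map q (Pair 0) (identity_simplex q)
        - chain_prism (q - 1) (P (q - 1)) (chain_boundary q (identity_simplex q))"
proof -
  let ?e = "\<lambda>q.
      chain_map q (Pair (1::real)) (identity_simplex q) - chain_map q (Pair 0) (identity_simplex q)"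
  \<comment> \<open>The invariant of the recursion is the boundary formula for cycles only, where it does not refer
     to the chain of the preceding degree; the boundary of the identity simplex is such a cycle.\<close>
  define good where "good q x \<longleftrightarrow> singular_chain (Suc q) (prism_space q) x \<and>
      (\<forall>Z :: (nat \<Rightarrow> real) topology. \<forall>c. singular_relcycle q Z {} c \<longrightarrow>
        chain_boundary (Suc q) (chain_prism q x c) = chain_map q (Pair 1) c - chain_map q (Pair 0) c)"
    for q x
  have chain_\<iota>: "singular_chain q (subtopology (powertop_real UNIV) (standard_simplex q))
      (identity_simplex q)" for q
    by (simp add: singular_chain_of singular_simplex_def)
  have Pair_cont: "continuous_map (subtopology (powertop_real UNIV) (standard_simplex q))
      (prism_space q) (Pair t)"
    if "t \<in> {0..1}" for q t
    using that by (simp add: continuous_map_pairwise comp_def)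
  \<comment> \<open>In degree 0 not every cycle bounds; but the end points are the images of one point under two
     homotopic maps into the prism, the homotopy being the identity.\<close>
  have good_start: "\<exists>x. good 0 x \<and> chain_boundary (Suc 0) x = ?e 0"
  proof -
    have "homotopic_with (\<lambda>_. True) (subtopology (powertop_real UNIV) (standard_simplex 0))
        (prism_space 0) (Pair 1) (Pair 0)"
      by (rule homotopic_with_sym[THEN iffD1], simp add: homotopic_with_def)
        (rule exI[of _ id], auto)
    then have "homologous_rel 0 (prism_space 0) {} (chain_map 0 (Pair 1) (identity_simplex 0))
        (chain_map 0 (Pair 0) (identity_simplex 0))"
      by (intro homotopic_imp_homologous_rel_chain_maps[where T = "{}"])
        (use chain_\<iota>[of 0] in \<open>auto simp: singular_cycle chain_boundary_def\<close>)
    then obtain x where x: "singular_chain (Suc 0) (prism_space 0) x" "chain_boundary (Suc 0) x = ?e 0"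
      unfolding homologous_rel_def singular_boundary by blast
    have "good 0 x"
      unfolding good_def
      using x chain_boundary_chain_prism[of 0 x 0] by (auto simp: chain_boundary_def singular_cycle)
    with x show ?thesis by blast
  qed
  have good_step: "\<exists>y. good (Suc q) y \<and>
      chain_boundary (Suc (Suc q)) y =
        ?e (Suc q) - chain_prism q x (chain_boundary (Suc q) (identity_simplex (Suc q)))"
    if x: "good q x" for q x
  proof -
    let ?\<iota> = "identity_simplex (Suc q)"
      and ?\<Delta> = "subtopology (powertop_real UNIV) (standard_simplex (Suc q))"
    let ?r = "?e (Suc q) - chain_prism q x (chain_boundary (Suc q) ?\<iota>)"
    have \<partial>: "singular_relcycle q ?\<Delta> {} (chain_boundary (Suc q) ?\<iota>)"
      using singular_chain_boundary_alt[OF chain_\<iota>] chain_boundary_boundary_alt[OF chain_\<iota>]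
      by (simp add: singular_cycle)
    have x': "singular_chain (Suc q) (prism_space q) x" using x by (simp add: good_def)
    have 1: "singular_chain (Suc q) (prism_space (Suc q)) ?r"
      using \<partial> x' singular_chain_chain_map[OF chain_\<iota> Pair_cont]
      by (intro singular_chain_diff singular_chain_chain_prism) (auto simp: singular_cycle)
    have "chain_boundary (Suc q) (chain_prism q x (chain_boundary (Suc q) ?\<iota>)) =
        chain_map q (Pair 1) (chain_boundary (Suc q) ?\<iota>) - chain_map q (Pair 0) (chain_boundary (Suc q) ?\<iota>)"
      using x \<partial> unfolding good_def by blast
    then have "chain_boundary (Suc q) ?r = 0"
      by (simp only: chain_boundary_diff chain_boundary_chain_map[OF chain_\<iota>] diff_Suc_Suc diff_zero diff_self)
    with 1 have "singular_relboundary (Suc q) (prism_space (Suc q)) {} ?r"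
      by (intro cycle_imp_boundary_contractible_space contractible_space_prism_space)
        (auto simp: singular_cycle)
    then obtain y where y: "singular_chain (Suc (Suc q)) (prism_space (Suc q)) y"
        "chain_boundary (Suc (Suc q)) y = ?r"
      unfolding singular_boundary by blast
    have "chain_boundary (Suc (Suc q)) (chain_prism (Suc q) y c) =
        chain_map (Suc q) (Pair 1) c - chain_map (Suc q) (Pair 0) c"
      if "singular_relcycle (Suc q) Z {} c" for Z :: "(nat \<Rightarrow> real) topology" and c
      using that chain_boundary_chain_prism[of "Suc q" y x Z c] y x'
      by (simp add: singular_cycle del: chain_map_of)
    with y(1) have "good (Suc q) y" unfolding good_def by blast
    with y show ?thesis by blast
  qed
  obtain P where P: "\<And>q. good q (P q) \<and> (q = 0 \<longrightarrow> chain_boundary (Suc 0) (P 0) = ?e 0)"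
    and step: "\<And>q. chain_boundary (Suc (Suc q)) (P (Suc q)) =
      ?e (Suc q) - chain_prism q (P q) (chain_boundary (Suc q) (identity_simplex (Suc q)))"
    using dependent_nat_choice[of
        "\<lambda>q x. good q x \<and> (q = 0 \<longrightarrow> chain_boundary (Suc 0) x = ?e 0)"
        "\<lambda>q x y. chain_boundary (Suc (Suc q)) y =
           ?e (Suc q) - chain_prism q x (chain_boundary (Suc q) (identity_simplex (Suc q)))"]
      good_start good_step by (metis nat.distinct(1))
  show thesis
  proof
    show "singular_chain (Suc q) (prism_space q) (P q)" for q
      using P by (simp add: good_def)
    show "chain_boundary (Suc q) (P q) =
        ?e q - chain_prism (q - 1) (P (q - 1)) (chain_boundary q (identity_simplex q))" for q
      using P step by (cases q) (auto simp: chain_boundary_def)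
  qed
qed

section \<open>Homotopic maps are chain homotopic\<close>

text \<open>A homotopy \<open>h\<close> pushes the prism over a chain to \<open>Y\<close>, and its restrictions to the ends of the prism
  are \<open>f\<close> and \<open>g\<close>.\<close>

lemma homotopic_imp_chain_homotopic:
  assumes "homotopic_with (\<lambda>_. True) X Y f g"
  obtains D :: "nat \<Rightarrow> 'a chain \<Rightarrow> 'b chain"
  where "\<And>q c. singular_chain q X c \<Longrightarrow> singular_chain (Suc q) Y (D q c)"
    and "\<And>q c d. D q (c + d) = D q c + D q d"
    and "\<And>q. D q 0 = 0"
    and "\<And>q c. singular_chain q X c \<Longrightarrow>
           chain_boundary (Suc q) (D q c) =
             chain_map q g c - chain_map q f c - D (q - 1) (chain_boundary q c)"
proof -
  obtain h where h: "continuous_map (prod_topology (top_of_set {0..1::real}) X) Y h"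
    and h01: "\<And>x. h (0, x) = f x" "\<And>x. h (1, x) = g x"
    using assms unfolding homotopic_with_def by blast
  obtain P where P: "\<And>q. singular_chain (Suc q) (prism_space q) (P q)"
    and bd: "\<And>q. chain_boundary (Suc q) (P q) =
      chain_map q (Pair 1) (identity_simplex q) - chain_map q (Pair 0) (identity_simplex q)
        - chain_prism (q - 1) (P (q - 1)) (chain_boundary q (identity_simplex q))"
    using prism_chains_exist by blast
  let ?D = "\<lambda>q c. chain_map (Suc q) h (chain_prism q (P q) c)"
  show thesis
  proof (rule that[of ?D])
    show "singular_chain (Suc q) Y (?D q c)" if "singular_chain q X c" for q c
      by (rule singular_chain_chain_map[OF singular_chain_chain_prism[OF P that] h])
    show "?D q (c + d) = ?D q c + ?D q d" for q c d
      by (simp add: chain_prism_add chain_map_add)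
    show "?D q 0 = 0" for q by simp
    fix q c assume c: "singular_chain q X c"
    have ends: "h \<circ> Pair 0 = f" "h \<circ> Pair 1 = g" by (auto simp: h01)
    have P': "0 < q \<Longrightarrow> singular_chain q (prism_space (q - 1)) (P (q - 1))"
      using P[of "q - 1"] by simp
    have "chain_boundary (Suc q) (?D q c) = chain_map q h (chain_boundary (Suc q) (chain_prism q (P q) c))"
      using chain_boundary_chain_map[OF singular_chain_chain_prism[OF P c]] by simp
    also have "\<dots> = chain_map q h (chain_map q (Pair 1) c - chain_map q (Pair 0) c
        - chain_prism (q - 1) (P (q - 1)) (chain_boundary q c))"
      by (simp only: chain_boundary_chain_prism[OF P P' bd c])
    also have "\<dots> = chain_map q g c - chain_map q f c
        - chain_map q h (chain_prism (q - 1) (P (q - 1)) (chain_boundary q c))"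
      unfolding chain_map_diff ends[symmetric] by (simp add: chain_map_compose)
    also have "chain_map q h (chain_prism (q - 1) (P (q - 1)) (chain_boundary q c)) =
        ?D (q - 1) (chain_boundary q c)"
      by (cases q) (simp_all add: chain_boundary_def)
    finally show "chain_boundary (Suc q) (?D q c) =
        chain_map q g c - chain_map q f c - ?D (q - 1) (chain_boundary q c)" .
  qed
qed

section \<open>Homotopy invariance of reduced cohomology\<close>

lemma cocycleD:
  assumes "\<phi> \<in> cocycles n R X"
  shows "\<phi> \<in> extensional (singular_chain_set n X)"
    and "\<And>c. singular_chain n X c \<Longrightarrow> \<phi> c \<in> carrier R"
    and "\<And>c d. singular_chain n X c \<Longrightarrow> singular_chain n X d \<Longrightarrow>
           \<phi> (c + d) = \<phi> c \<oplus>\<^bsub>R\<^esub> \<phi> d"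
    and "\<And>c. singular_chain (Suc n) X c \<Longrightarrow> \<phi> (chain_boundary (Suc n) c) = \<zero>\<^bsub>R\<^esub>"
proof -
  have \<phi>: "\<phi> \<in> carrier (cochain_group n R X)"
    and bd: "coboundary n X \<phi> = \<one>\<^bsub>cochain_group (Suc n) R X\<^esub>"
    using assms by (auto simp: cocycles_def)
  show "\<phi> \<in> extensional (singular_chain_set n X)"
    and "\<And>c. singular_chain n X c \<Longrightarrow> \<phi> c \<in> carrier R"
    and "\<And>c d. singular_chain n X c \<Longrightarrow> singular_chain n X d \<Longrightarrow>
           \<phi> (c + d) = \<phi> c \<oplus>\<^bsub>R\<^esub> \<phi> d"
    using \<phi> by (auto simp: cochain_carrier_iff)
  show "\<phi> (chain_boundary (Suc n) c) = \<zero>\<^bsub>R\<^esub>" if "singular_chain (Suc n) X c" for c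
    using fun_cong[OF bd, of c] that by (simp add: coboundary_def cochain_group_def)
qed

text \<open>Composing a cocycle \<open>\<phi>\<close> with the chain homotopy formula kills the term that is the boundary of
  \<open>D n c\<close>, so the two pullbacks of \<open>\<phi>\<close> differ by \<open>\<phi> \<circ> D (n - 1) \<circ> \<partial>\<close>. For positive \<open>n\<close> this is
  the coboundary of \<open>\<phi> \<circ> D (n - 1)\<close>; for \<open>n = 0\<close> it is zero. An actual chain homotopy is needed:
  the fact that homotopic maps send each cycle to homologous cycles does not control cochains with
  values in a general ring \<open>R\<close>.\<close>

lemma homotopic_imp_cochain_map_cohomologous:
  assumes R: "cring R" and hom: "homotopic_with (\<lambda>_. True) X Y f g" and \<phi>: "\<phi> \<in> cocycles n R Y"
  shows "cochain_map n X g \<phi> \<in> reduced_coboundaries n R X #>\<^bsub>cochain_group n R X\<^esub> cochain_map n X f \<phi>"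
proof -
  interpret cring R by fact
  let ?C = "cochain_group n R X"
  obtain D where D: "\<And>q c. singular_chain q X c \<Longrightarrow> singular_chain (Suc q) Y (D q c)"
    and D_add: "\<And>q c d. D q (c + d) = D q c + D q d" and D0: "\<And>q. D q 0 = 0"
    and bd: "\<And>q c. singular_chain q X c \<Longrightarrow> chain_boundary (Suc q) (D q c) =
        chain_map q g c - chain_map q f c - D (q - 1) (chain_boundary q c)"
    using homotopic_imp_chain_homotopic[OF hom] by blast
  have fg: "continuous_map X Y f" "continuous_map X Y g"
    using homotopic_with_imp_continuous_maps[OF hom] by auto
  note \<phi>_closed = cocycleD(2)[OF \<phi>] and \<phi>_add = cocycleD(3)[OF \<phi>] and \<phi>_bd = cocycleD(4)[OF \<phi>]
  have \<phi>_gf: "\<phi> (chain_map n g c) = \<phi> (D (n - 1) (chain_boundary n c)) \<oplus>\<^bsub>R\<^esub> \<phi> (chain_map n f c)"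
    if c: "singular_chain n X c" for c
  proof -
    have f: "singular_chain n Y (chain_map n f c)" and g: "singular_chain n Y (chain_map n g c)"
      using singular_chain_chain_map c fg by blast+
    have b: "singular_chain n Y (chain_boundary (Suc n) (D n c))"
      using singular_chain_boundary_alt D c by blast
    have e: "D (n - 1) (chain_boundary n c) =
        chain_map n g c - chain_map n f c - chain_boundary (Suc n) (D n c)"
      using bd[OF c] by (simp add: algebra_simps)
    have d: "singular_chain n Y (D (n - 1) (chain_boundary n c))"
      unfolding e using f g b by (intro singular_chain_diff)
    have "chain_map n g c =
        (D (n - 1) (chain_boundary n c) + chain_map n f c) + chain_boundary (Suc n) (D n c)"
      using e by simp
    then have "\<phi> (chain_map n g c) =
        (\<phi> (D (n - 1) (chain_boundary n c)) \<oplus>\<^bsub>R\<^esub> \<phi> (chain_map n f c))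
          \<oplus>\<^bsub>R\<^esub> \<phi> (chain_boundary (Suc n) (D n c))"
      using d f b by (simp only: \<phi>_add singular_chain_add)
    then show "\<phi> (chain_map n g c) = \<phi> (D (n - 1) (chain_boundary n c)) \<oplus>\<^bsub>R\<^esub> \<phi> (chain_map n f c)"
      using d f D[OF c] by (simp add: \<phi>_bd \<phi>_closed)
  qed
  let ?\<beta> = "\<lambda>c\<in>singular_chain_set n X. \<phi> (D (n - 1) (chain_boundary n c))"
  have "?\<beta> \<in> reduced_coboundaries n R X"
  proof (cases n)
    case 0
    have "\<phi> 0 = \<zero>\<^bsub>R\<^esub>" using \<phi>_bd[of 0] by simp
    then have "?\<beta> = (\<lambda>c\<in>singular_chain_set 0 X. [augmentation c] \<cdot>\<^bsub>R\<^esub> \<zero>\<^bsub>R\<^esub>)"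
      by (auto simp: 0 chain_boundary_def D0 fun_eq_iff)
    then show ?thesis unfolding 0 reduced_coboundaries_def by (simp only: nat.case) blast
  next
    case (Suc m)
    let ?\<psi> = "\<lambda>c\<in>singular_chain_set m X. \<phi> (D m c)"
    have "?\<psi> \<in> carrier (cochain_group m R X)"
      unfolding cochain_carrier_iff
      using D \<phi>_closed \<phi>_add Suc by (auto simp: D_add singular_chain_add)
    moreover have "?\<beta> = coboundary m X ?\<psi>"
      using singular_chain_boundary_alt[of m X] by (auto simp: Suc coboundary_def fun_eq_iff)
    ultimately show ?thesis by (auto simp: Suc reduced_coboundaries_def)
  qed
  moreover have "cochain_map n X g \<phi> = ?\<beta> \<otimes>\<^bsub>?C\<^esub> cochain_map n X f \<phi>"
    using \<phi>_gf by (auto simp: cochain_map_def cochain_group_def fun_eq_iff)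
  ultimately show ?thesis by (auto simp: r_coset_def)
qed

section \<open>Reduced cohomology of a point\<close>

text \<open>There is one singular simplex \<open>\<sigma>\<^sub>k\<close> in each degree \<open>k\<close>; its boundary is \<open>\<sigma>\<^bsub>k-1\<^esub>\<close> for even
  \<open>k > 0\<close> and 0 for odd \<open>k\<close>. In degree 0 a cochain is a multiple of the augmentation.
  In odd degrees every chain is a boundary, hence cocycles vanish. In even
  positive degrees a cochain \<open>\<phi>\<close> is the coboundary of the cochain with value \<open>\<phi> \<sigma>\<^sub>n\<close> on
  \<open>\<sigma>\<^bsub>n-1\<^esub>\<close>.\<close>

lemma cocycles_singleton:
  fixes X :: "'a topology"
  assumes R: "cring R" and X: "topspace X = {a}"
  shows "cocycles n R X \<subseteq> reduced_coboundaries n R X"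
proof
  interpret cring R by fact
  fix \<phi> assume \<phi>: "\<phi> \<in> cocycles n R X"
  let ?pt = "\<lambda>k. frag_of (\<lambda>x\<in>standard_simplex k. a)"
  note \<phi>_ext = cocycleD(1)[OF \<phi>] and \<phi>_closed = cocycleD(2)[OF \<phi>]
    and \<phi>_add = cocycleD(3)[OF \<phi>] and \<phi>_bd = cocycleD(4)[OF \<phi>]
  have pt: "singular_chain k X (?pt k)" for k
    by (simp add: singular_chain_of singular_simplex_singleton[OF X])
  consider "n = 0" | "odd n" | m where "n = Suc m" "even n"
    by (metis not0_implies_Suc)
  then show "\<phi> \<in> reduced_coboundaries n R X"
  proof cases
    case 1
    have "\<phi> c = [augmentation c] \<cdot>\<^bsub>R\<^esub> \<phi> (?pt 0)" if c: "singular_chain 0 X c" for c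
    proof -
      obtain b where b: "c = frag_cmul b (?pt 0)"
        using c singular_chain_singleton[OF X] by blast
      interpret \<phi>: group_hom "chain_group 0 X" "add_monoid R" \<phi>
        using \<phi> 1 add.group_axioms
        by (simp add: group_hom_def group_hom_axioms_def cocycles_def cochain_group_def)
      have "\<phi> (?pt 0 [^]\<^bsub>chain_group 0 X\<^esub> b) = [b] \<cdot>\<^bsub>R\<^esub> \<phi> (?pt 0)"
        using \<phi>.hom_int_pow[of "?pt 0" b] pt[of 0] by (simp add: add_pow_def)
      moreover have "augmentation c = b"
        by (cases "b = 0") (simp_all add: b augmentation_def Poly_Mapping.keys.rep_eq)
      ultimately show ?thesis
        by (simp add: b chain_group_def singular_simplex_singleton[OF X])
    qed
    then have "\<phi> = (\<lambda>c\<in>singular_chain_set 0 X. [augmentation c] \<cdot>\<^bsub>R\<^esub> \<phi> (?pt 0))"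
      using \<phi>_ext 1 by (auto simp: fun_eq_iff extensional_def)
    then show ?thesis
      using \<phi>_closed pt 1 by (auto simp: reduced_coboundaries_def)
  next
    case 2
    have "\<phi> c = \<zero>\<^bsub>R\<^esub>" if c: "singular_chain n X c" for c
      using c 2 singular_boundary_singleton[OF X, of n c] \<phi>_bd unfolding singular_boundary by blast
    then have "\<phi> = \<one>\<^bsub>cochain_group n R X\<^esub>"
      using \<phi>_ext by (auto simp: cochain_group_def fun_eq_iff extensional_def)
    then show ?thesis
      using subgroup.one_closed[OF subgroup_reduced_coboundaries[OF R]] by simp
  next
    case (3 m)
    \<comment> \<open>the homomorphism that sends \<open>\<sigma>\<^bsub>n-1\<^esub>\<close> to \<open>\<sigma>\<^sub>n\<close>\<close>
    let ?s = "frag_extend (\<lambda>_. ?pt n) :: 'a chain \<Rightarrow> 'a chain"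
    let ?\<psi> = "\<lambda>c\<in>singular_chain_set m X. \<phi> (?s c)"
    have s: "singular_chain n X (?s c)" for c
      using pt by (intro singular_chain_extend)
    have "?\<psi> \<in> carrier (cochain_group m R X)"
      unfolding cochain_carrier_iff
      using s \<phi>_closed \<phi>_add by (auto simp: frag_extend_add singular_chain_add)
    moreover have "coboundary m X ?\<psi> = \<phi>"
    proof
      fix c
      show "coboundary m X ?\<psi> c = \<phi> c"
      proof (cases "singular_chain n X c")
        case True
        then obtain b where b: "c = frag_cmul b (?pt n)"
          using singular_chain_singleton[OF X] by blast
        have "?s (chain_boundary n c) = c"
          using 3 chain_boundary_of_singleton[OF X True]
          by (simp add: b frag_extend_cmul)
        then show ?thesis
          using True 3 singular_chain_boundary_alt[of m X c] by (simp add: coboundary_def)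
      qed (use \<phi>_ext 3 in \<open>auto simp: coboundary_def extensional_def\<close>)
    qed
    ultimately have "\<phi> \<in> coboundary m X ` carrier (cochain_group m R X)"
      by (metis (no_types) rev_image_eqI)
    then show ?thesis by (simp add: 3(1) reduced_coboundaries_def)
  qed
qed

section \<open>Passage to cohomology classes\<close>

lemma coset_eq_one_reduced_cohomology_iff:
  assumes R: "cring R" and \<phi>: "\<phi> \<in> cocycles n R X"
  shows "reduced_coboundaries n R X #>\<^bsub>cochain_group n R X\<^esub> \<phi> = \<one>\<^bsub>reduced_cohomology_group n R X\<^esub> \<longleftrightarrow>
    \<phi> \<in> reduced_coboundaries n R X"
proof -
  interpret group "cochain_group n R X" by (rule group_cochain_group[OF R])
  have B: "subgroup (reduced_coboundaries n R X) (cochain_group n R X)"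
    by (rule subgroup_reduced_coboundaries[OF R])
  have "\<phi> \<in> carrier (cochain_group n R X)" using \<phi> by (simp add: cocycles_def)
  then show ?thesis
    using coset_join1[OF _ _ B] coset_join2[OF _ B] subgroup.subset[OF B]
    by (auto simp: reduced_cohomology_group_def FactGroup_def)
qed

lemma carrier_reduced_cohomology_obtain_cocycle:
  assumes R: "cring R" and \<alpha>: "\<alpha> \<in> carrier (reduced_cohomology R X)"
  obtains \<phi> where "\<phi> \<in> cocycles n R X"
    and "\<alpha> n = reduced_coboundaries n R X #>\<^bsub>cochain_group n R X\<^esub> \<phi>"
proof -
  have "group (reduced_cohomology_group k R X)" for k
    by (rule comm_group.axioms(2)[OF comm_group_reduced_cohomology_group[OF R]])
  then have "\<alpha> n \<in> carrier (reduced_cohomology_group n R X)"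
    using \<alpha> by (auto simp: reduced_cohomology_def carrier_sum_group)
  then show ?thesis
    using that by (auto simp: reduced_cohomology_group_def FactGroup_def RCOSETS_def r_coset_def)
qed

text \<open>Pulling a class of \<open>X\<close> back along \<open>i\<close> and then along \<open>r\<close> is pulling it back along a map homotopic
  to the identity, so a class killed by \<open>i\<close> is trivial.\<close>

lemma reduced_cohomology_map_injective_if_homotopy_right_inverse:
  assumes R: "cring R" and i: "continuous_map Y X i" and r: "continuous_map X Y r"
    and hom: "homotopic_with (\<lambda>_. True) X X (i \<circ> r) id"
    and \<alpha>: "\<alpha> \<in> carrier (reduced_cohomology R X)"
    and triv: "reduced_cohomology_map R Y i \<alpha> = \<one>\<^bsub>reduced_cohomology R Y\<^esub>"
  shows "\<alpha> = \<one>\<^bsub>reduced_cohomology R X\<^esub>"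
proof
  fix n
  interpret group "cochain_group n R X" by (rule group_cochain_group[OF R])
  obtain \<phi> where \<phi>: "\<phi> \<in> cocycles n R X"
    and \<alpha>n: "\<alpha> n = reduced_coboundaries n R X #>\<^bsub>cochain_group n R X\<^esub> \<phi>"
    using carrier_reduced_cohomology_obtain_cocycle[OF R \<alpha>] by blast
  have "reduced_cohomology_map_deg n R Y i (\<alpha> n) = \<one>\<^bsub>reduced_cohomology_group n R Y\<^esub>"
    using fun_cong[OF triv, of n] by (simp add: reduced_cohomology_map_def reduced_cohomology_def)
  then have "cochain_map n Y i \<phi> \<in> reduced_coboundaries n R Y"
    using reduced_cohomology_map_coset[OF R i \<phi>] by (simp add: \<alpha>n coset_eq_one_reduced_cohomology_iff[OF R])
  then have "cochain_map n X r (cochain_map n Y i \<phi>) \<in> reduced_coboundaries n R X"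
    using cochain_map_reduced_coboundaries[OF R r] by blast
  moreover have "cochain_map n X r (cochain_map n Y i \<phi>) = cochain_map n X (i \<circ> r) \<phi>"
    using singular_chain_chain_map[OF _ r]
    by (auto simp: cochain_map_def chain_map_compose fun_eq_iff)
  moreover have "cochain_map n X id \<phi> = \<phi>"
    using \<phi> by (auto simp: cochain_map_def chain_map_ident cocycles_def cochain_carrier_iff
        fun_eq_iff extensional_def)
  ultimately have "\<phi> \<in> reduced_coboundaries n R X"
    using homotopic_imp_cochain_map_cohomologous[OF R hom \<phi>]
      coset_join2[OF _ subgroup_reduced_coboundaries[OF R]]
      subgroup.mem_carrier[OF subgroup_reduced_coboundaries[OF R]] by metis
  then show "\<alpha> n = \<one>\<^bsub>reduced_cohomology R X\<^esub> n"
    using coset_eq_one_reduced_cohomology_iff[OF R \<phi>] by (simp add: \<alpha>n reduced_cohomology_def)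
qed

lemma reduced_cohomology_singleton:
  assumes R: "cring R" and X: "topspace X = {a}" and \<alpha>: "\<alpha> \<in> carrier (reduced_cohomology R X)"
  shows "\<alpha> = \<one>\<^bsub>reduced_cohomology R X\<^esub>"
proof
  fix n
  obtain \<phi> where \<phi>: "\<phi> \<in> cocycles n R X"
    and \<alpha>n: "\<alpha> n = reduced_coboundaries n R X #>\<^bsub>cochain_group n R X\<^esub> \<phi>"
    using carrier_reduced_cohomology_obtain_cocycle[OF R \<alpha>] by blast
  then show "\<alpha> n = \<one>\<^bsub>reduced_cohomology R X\<^esub> n"
    using cocycles_singleton[OF R X, of n] coset_eq_one_reduced_cohomology_iff[OF R \<phi>]
    by (auto simp: reduced_cohomology_def)
qed

section \<open>Sections of the projection of the configuration space\<close>

lemma min_root_number_eq_0_iff: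
  "min_root_number X Y f a = 0 \<longleftrightarrow>
    (\<exists>g. homotopic_with (\<lambda>_. True) X Y g f \<and> (\<forall>x\<in>topspace X. g x \<noteq> a))"
proof -
  have "min_root_number X Y f a = 0 \<longleftrightarrow> min_root_number X Y f a < 1"
    by (metis iless_eSuc0 one_eSuc zero_less_one)
  moreover have "ecard A < 1 \<longleftrightarrow> A = {}" for A :: "'a set"
    by (auto simp: ecard_def one_enat_def)
  ultimately show ?thesis
    by (auto simp: min_root_number_def INF_less_iff)
qed

text \<open>This is where root numbers meet sections: deforming the projection \<open>p\<close> away from \<open>a\<close> deforms
  \<open>p \<circ> s = id\<close> to a map that misses \<open>a\<close>.\<close>

lemma root_free_map_section_imp_deformation_off_point:
  assumes g: "homotopic_with (\<lambda>_. True) E X g p" and no_root: "\<forall>x\<in>topspace E. g x \<noteq> a"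
    and s: "continuous_map X E s" and ps: "\<And>x. x \<in> topspace X \<Longrightarrow> p (s x) = x"
  shows "continuous_map X (subtopology X (topspace X - {a})) (g \<circ> s)"
    and "homotopic_with (\<lambda>_. True) X X (g \<circ> s) id"
proof -
  have gc: "continuous_map E X g"
    using homotopic_with_imp_continuous_maps[OF g] by blast
  have "continuous_map X X (g \<circ> s)" by (rule continuous_map_compose[OF s gc])
  moreover have "(g \<circ> s) x \<in> topspace X - {a}" if "x \<in> topspace X" for x
    using that no_root continuous_map_image_subset_topspace[OF s]
      continuous_map_image_subset_topspace[OF gc] by auto
  ultimately show "continuous_map X (subtopology X (topspace X - {a})) (g \<circ> s)"
    by (intro continuous_map_into_subtopology) auto
  have "homotopic_with (\<lambda>_. True) X X (g \<circ> s) (p \<circ> s)"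
    by (rule homotopic_with_compose_continuous_map_right[OF g s]) simp
  then show "homotopic_with (\<lambda>_. True) X X (g \<circ> s) id"
    by (rule homotopic_with_eq) (auto simp: ps)
qed

lemma has_local_section_config2_off_point:
  assumes "a \<in> topspace X"
  shows "has_local_section (config2 X) X fst (topspace X - {a})"
  unfolding has_local_section_def config2_def
proof (intro exI[of _ "\<lambda>x. (x, a)"] conjI continuous_map_into_subtopology)
  show "continuous_map (subtopology X (topspace X - {a})) (prod_topology X X) (\<lambda>x. (x, a))"
    using assms by (simp add: continuous_map_pairwise comp_def)
qed auto

lemma fixed_point_property_if_no_section_config2:
  assumes "\<not> has_local_section (config2 X) X fst (topspace X)"
  shows "fixed_point_property X"
  unfolding fixed_point_property_def
proof (intro allI impI, rule ccontr)
  fix f assume f: "continuous_map X X f" and no_fix: "\<not> (\<exists>x\<in>topspace X. f x = x)"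
  have "continuous_map X (config2 X) (\<lambda>x. (x, f x))"
    unfolding config2_def
  proof (rule continuous_map_into_subtopology)
    show "continuous_map X (prod_topology X X) (\<lambda>x. (x, f x))"
      using f by (simp add: continuous_map_pairwise comp_def)
    show "(\<lambda>x. (x, f x)) \<in> topspace X \<rightarrow> {(x, y). x \<noteq> y}"
      using no_fix by fastforce
  qed
  then have "has_local_section (config2 X) X fst (topspace X)"
    unfolding has_local_section_def by (intro exI[of _ "\<lambda>x. (x, f x)"]) simp
  with assms show False by blast
qed

lemma sectional_number_ge_2:
  assumes ne: "topspace B \<noteq> {}" and no: "\<not> has_local_section E B p (topspace B)"
  shows "2 \<le> sectional_number E B p"
  unfolding sectional_number_def
proof (rule INF_greatest)
  fix \<U> assume "\<U> \<in> {\<U>. (\<forall>U\<in>\<U>. openin B U \<and> has_local_section E B p U) \<and> \<Union>\<U> = topspace B}"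
  then have \<U>: "\<forall>U\<in>\<U>. has_local_section E B p U" "\<Union>\<U> = topspace B" by auto
  show "2 \<le> ecard \<U>"
  proof (cases "finite \<U>")
    case True
    have "card \<U> \<noteq> 0" using \<U>(2) ne True by (metis Union_empty card_eq_0_iff)
    moreover have "card \<U> \<noteq> 1" using \<U> no by (auto simp: card_1_singleton_iff)
    ultimately have "2 \<le> card \<U>" by linarith
    then show ?thesis using True by (simp add: ecard_def numeral_eq_enat)
  qed (simp add: ecard_def)
qed

lemma sectional_number_config2_le_2:
  assumes X: "t1_space X" and ab: "a \<in> topspace X" "b \<in> topspace X" "a \<noteq> b"
  shows "sectional_number (config2 X) X fst \<le> 2"
proof -
  let ?\<U> = "{topspace X - {a}, topspace X - {b}}"
  have "openin X (topspace X - {c})" if "c \<in> topspace X" for c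
    using X that by (simp add: openin_diff t1_space_closedin_singleton)
  then have "sectional_number (config2 X) X fst \<le> ecard ?\<U>"
    unfolding sectional_number_def
    using ab by (intro INF_lower) (auto simp: has_local_section_config2_off_point)
  also have "\<dots> \<le> 2"
    by (simp add: ecard_def numeral_eq_enat card_insert_if)
  finally show ?thesis .
qed

section \<open>The sectional number and the fixed point property\<close>

theorem proposition3p23:
  fixes X :: "'a topology" and R :: "('r, 'm) ring_scheme" and x\<^sub>0 :: 'a
  assumes "CW_complex X" and "connected_space X"
    and "cring R"
    and "x\<^sub>0 \<in> topspace X"
    and "min_root_number (config2 X) X fst x\<^sub>0 = 0"
    and "\<exists>\<alpha> \<in> carrier (reduced_cohomology R X).
           \<alpha> \<noteq> \<one>\<^bsub>reduced_cohomology R X\<^esub> \<and>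
           reduced_cohomology_map R (subtopology X (topspace X - {x\<^sub>0})) id \<alpha>
             = \<one>\<^bsub>reduced_cohomology R (subtopology X (topspace X - {x\<^sub>0}))\<^esub>"
  shows "sectional_number (config2 X) X fst = 2 \<and> fixed_point_property X"
proof -
  obtain \<alpha> where \<alpha>: "\<alpha> \<in> carrier (reduced_cohomology R X)" "\<alpha> \<noteq> \<one>\<^bsub>reduced_cohomology R X\<^esub>"
    and \<alpha>_vanishes: "reduced_cohomology_map R (subtopology X (topspace X - {x\<^sub>0})) id \<alpha>
             = \<one>\<^bsub>reduced_cohomology R (subtopology X (topspace X - {x\<^sub>0}))\<^esub>"
    using assms(6) by blast
  obtain g where g: "homotopic_with (\<lambda>_. True) (config2 X) X g fst"
      "\<forall>z\<in>topspace (config2 X). g z \<noteq> x\<^sub>0"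
    using assms(5) unfolding min_root_number_eq_0_iff by blast
  have no_section: "\<not> has_local_section (config2 X) X fst (topspace X)"
  proof
    assume "has_local_section (config2 X) X fst (topspace X)"
    then obtain s where s: "continuous_map X (config2 X) s" "\<And>x. x \<in> topspace X \<Longrightarrow> fst (s x) = x"
      unfolding has_local_section_def by auto
    note r = root_free_map_section_imp_deformation_off_point[OF g s]
    have "\<alpha> = \<one>\<^bsub>reduced_cohomology R X\<^esub>"
      by (rule reduced_cohomology_map_injective_if_homotopy_right_inverse[OF assms(3) _ r(1) _
              \<alpha>(1) \<alpha>_vanishes])
        (use r(2) in simp_all)
    with \<alpha>(2) show False by blast
  qed
  have "topspace X \<noteq> {x\<^sub>0}"
    using reduced_cohomology_singleton[OF assms(3) _ \<alpha>(1)] \<alpha>(2) by blast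
  then obtain x\<^sub>1 where x\<^sub>1: "x\<^sub>1 \<in> topspace X" "x\<^sub>0 \<noteq> x\<^sub>1"
    using assms(4) by blast
  have "t1_space X"
    using assms(1) by (simp add: CW_complex_def Hausdorff_imp_t1_space)
  then have "sectional_number (config2 X) X fst \<le> 2"
    by (rule sectional_number_config2_le_2[OF _ assms(4) x\<^sub>1])
  moreover have "2 \<le> sectional_number (config2 X) X fst"
    by (rule sectional_number_ge_2[OF _ no_section]) (use assms(4) in auto)
  ultimately show ?thesis
    using fixed_point_property_if_no_section_config2[OF no_section] by simp
qed

end
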